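(* For every positive integer $k$ and every real number $\alpha > 0$, the additive monoid $\mathbb{N}_0[\alpha]$ is not $k$-furcus.
   Context: $\mathbb{N}_0$ is the set of nonnegative integers. For a positive real $\alpha$, $\mathbb{N}_0[\alpha] = \{p(\alpha) \mid p(X) \in \mathbb{N}_0[X]\}$, where $\mathbb{N}_0[X]$ is the set of polynomials with nonnegative integer coefficients; it is regarded as a monoid under addition. Its only invertible element is $0$. An atom of $M = \mathbb{N}_0[\alpha]$ is a nonzero element that is not the sum of two nonzero elements of $M$. $M$ is atomic if every nonzero element is a sum of finitely many atoms. A factorization of $b \in M$ is a formal sum (finite multiset) of atoms of $M$ whose actual sum is $b$; its length is the number of atoms in it, counting repetitions; and $\mathsf{L}(b)$ is the set of lengths of all factorizations of $b$. For a positive integer $k$, the monoid $M$ is called $k$-furcus if $M$ is atomic and $\mathsf{L}(x) \cap \{1, \dots, k\} \neq \emptyset$ for every non-invertible (that is, nonzero) element $x \in M$. *)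

theory Defs
  imports Complex_Main "HOL-Library.Multiset" "HOL-Computational_Algebra.Polynomial"
begin

definition N0_adjoin :: "real \<Rightarrow> real set" where
  "N0_adjoin \<alpha> = {poly (map_poly real p) \<alpha> | p :: nat poly. True}"

(* The notions below are for additive submonoids M in which 0 is the only invertible
   element; "non-invertible" is therefore rendered as "nonzero". *)

definition monoid_atom :: "'a::comm_monoid_add set \<Rightarrow> 'a \<Rightarrow> bool" where
  "monoid_atom M a \<longleftrightarrow>
     a \<in> M \<and> a \<noteq> 0 \<and> \<not> (\<exists>x\<in>M. \<exists>y\<in>M. x \<noteq> 0 \<and> y \<noteq> 0 \<and> a = x + y)"

definition factorizations :: "'a::comm_monoid_add set \<Rightarrow> 'a \<Rightarrow> 'a multiset set" where
  "factorizations M b = {F. (\<forall>a\<in>#F. monoid_atom M a) \<and> \<Sum>\<^sub># F = b}"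

definition atomic_monoid :: "'a::comm_monoid_add set \<Rightarrow> bool" where
  "atomic_monoid M \<longleftrightarrow> (\<forall>x\<in>M. x \<noteq> 0 \<longrightarrow> factorizations M x \<noteq> {})"

definition length_set :: "'a::comm_monoid_add set \<Rightarrow> 'a \<Rightarrow> nat set" where
  "length_set M b = size ` factorizations M b"

definition k_furcus :: "nat \<Rightarrow> 'a::comm_monoid_add set \<Rightarrow> bool" where
  "k_furcus k M \<longleftrightarrow>
     atomic_monoid M \<and> (\<forall>x\<in>M. x \<noteq> 0 \<longrightarrow> length_set M x \<inter> {1..k} \<noteq> {})"

lemma zero_in_N0_adjoin: "0 \<in> N0_adjoin \<alpha>"
  unfolding N0_adjoin_def by (auto intro!: exI[of _ 0])

lemma add_in_N0_adjoin:
  assumes "x \<in> N0_adjoin \<alpha>" "y \<in> N0_adjoin \<alpha>"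
  shows "x + y \<in> N0_adjoin \<alpha>"
proof -
  obtain p q :: "nat poly" where "x = poly (map_poly real p) \<alpha>" "y = poly (map_poly real q) \<alpha>"
    using assms unfolding N0_adjoin_def by auto
  moreover have "map_poly real (p + q) = map_poly real p + map_poly real q"
    by (intro poly_eqI) (simp add: coeff_map_poly)
  ultimately have "x + y = poly (map_poly real (p + q)) \<alpha>" by simp
  then show ?thesis unfolding N0_adjoin_def by blast
qed

lemma N0_adjoin_nonneg:
  assumes "\<alpha> > 0" "x \<in> N0_adjoin \<alpha>"
  shows "x \<ge> 0"
  using assms unfolding N0_adjoin_def
  by (auto simp: poly_altdef coeff_map_poly intro!: sum_nonneg)

lemma N0_adjoin_only_zero_invertible:
  assumes "\<alpha> > 0" "x \<in> N0_adjoin \<alpha>" "y \<in> N0_adjoin \<alpha>" "x + y = 0"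
  shows "x = 0"
  using N0_adjoin_nonneg[of \<alpha> x] N0_adjoin_nonneg[of \<alpha> y] assms by linarith

end

theory Submission
  imports Defs "HOL-Real_Asymp.Real_Asymp"
begin

text \<open>
  Every atom of \<open>\<nat>\<^sub>0[\<alpha>]\<close> is a power of \<open>\<alpha>\<close>, so in a \<open>k\<close>-furcus monoid every positive integer
  is a sum of at most \<open>k\<close> powers of \<open>\<alpha>\<close>. If \<open>\<alpha> \<le> 1\<close>, such a sum is at most \<open>k\<close>, which rules out
  \<open>k + 1\<close>. If \<open>\<alpha> > 1\<close>, a sum below \<open>\<alpha>\<^sup>N\<close> only involves exponents below \<open>N\<close>, so there are only
  \<open>O(N\<^sup>k)\<close> of them, whereas there are about \<open>\<alpha>\<^sup>N\<close> positive integers below \<open>\<alpha>\<^sup>N\<close>.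
\<close>

lemma power_in_N0_adjoin: "\<alpha> ^ i \<in> N0_adjoin \<alpha>"
proof -
  have "map_poly real (monom 1 i) = monom 1 i"
    by (intro poly_eqI) (simp add: coeff_map_poly)
  then have "\<alpha> ^ i = poly (map_poly real (monom 1 i)) \<alpha>"
    by (simp add: poly_monom)
  then show ?thesis
    unfolding N0_adjoin_def by blast
qed

lemma of_nat_in_N0_adjoin: "real n \<in> N0_adjoin \<alpha>"
proof (induction n)
  case (Suc n)
  then show ?case
    using add_in_N0_adjoin[OF power_in_N0_adjoin[of \<alpha> 0]] by simp
qed (simp add: zero_in_N0_adjoin)

text \<open>A polynomial representing the atom has some nonzero coefficient, so one copy of
  \<open>\<alpha> ^ i\<close> splits off. Since \<open>\<alpha> ^ i\<close> is nonzero,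
  indecomposability forces the remainder to have value 0.\<close>

lemma monoid_atom_N0_adjoinE:
  assumes "\<alpha> > 0" and "monoid_atom (N0_adjoin \<alpha>) a"
  obtains i where "a = \<alpha> ^ i"
proof -
  from assms(2) obtain p :: "nat poly" where p: "a = poly (map_poly real p) \<alpha>" and "a \<noteq> 0"
    unfolding monoid_atom_def N0_adjoin_def by auto
  then have "p \<noteq> 0" by auto
  then obtain i where i: "coeff p i \<noteq> 0"
    by (metis leading_coeff_0_iff)
  \<comment> \<open>Subtraction on \<open>nat\<close> coefficients truncates, but coefficient
    \<open>i\<close> is at least 1, so nothing is lost and the remainder still has coefficients in
    \<open>nat\<close>.\<close>
  define q where "q = p - monom 1 i"
  have "map_poly real p = map_poly real q + monom 1 i"
    using i by (intro poly_eqI) (auto simp: q_def coeff_map_poly)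
  then have eq: "a = poly (map_poly real q) \<alpha> + \<alpha> ^ i"
    using p by (simp add: poly_monom)
  moreover have "poly (map_poly real q) \<alpha> \<in> N0_adjoin \<alpha>"
    unfolding N0_adjoin_def by blast
  ultimately have "poly (map_poly real q) \<alpha> = 0"
    using assms power_in_N0_adjoin[of \<alpha> i] unfolding monoid_atom_def by force
  with eq that show thesis by simp
qed

text \<open>The list enumerates the exponents of the atoms in a short factorization of
  \<open>real n\<close>. Fixing an order turns multisets into lists, whose number is easy to
  bound.\<close>

lemma k_furcus_imp_sum_powers:
  assumes "\<alpha> > 0" and "k_furcus k (N0_adjoin \<alpha>)" and "n > 0"
  obtains es where "length es \<le> k" and "(\<Sum>i\<leftarrow>es. \<alpha> ^ i) = real n"
proof -
  have "length_set (N0_adjoin \<alpha>) (real n) \<inter> {1..k} \<noteq> {}"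
    using assms of_nat_in_N0_adjoin[of n \<alpha>] unfolding k_furcus_def by auto
  then obtain F where F: "size F \<le> k" "\<Sum>\<^sub># F = real n"
    and atoms: "\<And>a. a \<in># F \<Longrightarrow> monoid_atom (N0_adjoin \<alpha>) a"
    unfolding length_set_def factorizations_def by force
  obtain xs where xs: "mset xs = F"
    using ex_mset by blast
  have "\<forall>x\<in>set xs. \<exists>i. x = \<alpha> ^ i"
  proof
    fix x assume "x \<in> set xs"
    then have "monoid_atom (N0_adjoin \<alpha>) x"
      using atoms xs by auto
    then show "\<exists>i. x = \<alpha> ^ i"
      using monoid_atom_N0_adjoinE[OF assms(1)] by blast
  qed
  then obtain es where "xs = map (\<lambda>i. \<alpha> ^ i) es"
    by (auto simp flip: ex_map_conv)
  with xs F have "length es \<le> k" "(\<Sum>i\<leftarrow>es. \<alpha> ^ i) = real n"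
    by (auto simp flip: sum_mset_sum_list)
  then show thesis by (rule that)
qed

lemma card_lists_length_le_bound:
  assumes "finite A" and "A \<noteq> {}"
  shows "card {xs. set xs \<subseteq> A \<and> length xs \<le> k} \<le> (k + 1) * card A ^ k"
proof -
  have "card A \<ge> 1"
    using assms by (simp add: Suc_le_eq card_gt_0_iff)
  \<comment> \<open>There are \<open>card A ^ i\<close> lists of length \<open>i\<close>; as the
    base is at least 1, the term for \<open>i = k\<close> dominates all \<open>k + 1\<close> of
    them.\<close>
  then have "(\<Sum>i\<le>k. card A ^ i) \<le> (\<Sum>i\<le>k. card A ^ k)"
    by (intro sum_mono power_increasing) auto
  then show ?thesis
    using assms(1) by (simp add: card_lists_length_le)
qed

lemma power_le_if_sums_of_powers:
  fixes \<alpha> :: real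
  assumes "\<alpha> > 1" and "N > 0"
    and sums: "\<And>n. n > 0 \<Longrightarrow> \<exists>es. length es \<le> k \<and> (\<Sum>i\<leftarrow>es. \<alpha> ^ i) = real n"
  shows "\<alpha> ^ N \<le> (real k + 1) * real N ^ k + 1"
proof -
  define L where "L = {es. set es \<subseteq> {..<N} \<and> length es \<le> k}"
  \<comment> \<open>With the ceiling, \<open>{1..<m}\<close> consists of exactly the positive
    integers strictly below \<open>\<alpha> ^ N\<close>.\<close>
  define m where "m = nat \<lceil>\<alpha> ^ N\<rceil>"
  have "real ` {1..<m} \<subseteq> (\<lambda>es. \<Sum>i\<leftarrow>es. \<alpha> ^ i) ` L"
  proof clarify
    fix n assume "n \<in> {1..<m}"
    then have "n > 0" and less: "real n < \<alpha> ^ N"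
      unfolding m_def by (auto, linarith)
    obtain es where es: "length es \<le> k" "(\<Sum>i\<leftarrow>es. \<alpha> ^ i) = real n"
      using sums[OF \<open>n > 0\<close>] by blast
    have "i < N" if "i \<in> set es" for i
    proof -
      \<comment> \<open>All summands are positive, so no single one exceeds the total.\<close>
      have "\<alpha> ^ i \<le> (\<Sum>i\<leftarrow>es. \<alpha> ^ i)"
        using that assms(1) by (intro member_le_sum_list) auto
      with es less have "\<alpha> ^ i < \<alpha> ^ N" by simp
      with assms(1) show ?thesis by simp
    qed
    with es show "real n \<in> (\<lambda>es. \<Sum>i\<leftarrow>es. \<alpha> ^ i) ` L"
      unfolding L_def by (intro image_eqI[of _ _ es]) auto
  qed
  moreover have "finite L"
    using finite_lists_length_le[of "{..<N}" k] by (simp add: L_def)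
  ultimately have "card (real ` {1..<m}) \<le> card L"
    by (meson card_image_le card_mono finite_imageI le_trans)
  also have "\<dots> \<le> (k + 1) * N ^ k"
    using card_lists_length_le_bound[of "{..<N}" k] assms(2) by (auto simp: L_def lessThan_empty_iff)
  \<comment> \<open>The set \<open>{1..<m}\<close> has only \<open>m - 1\<close> elements, whence
    the final \<open>+ 1\<close>.\<close>
  finally have "m \<le> (k + 1) * N ^ k + 1"
    by (simp add: card_image)
  then have "real m \<le> real ((k + 1) * N ^ k + 1)"
    by (simp only: of_nat_le_iff)
  moreover have "\<alpha> ^ N \<le> real m"
    unfolding m_def by linarith
  ultimately show ?thesis by (simp add: algebra_simps)
qed

theorem proposition3p4:
  fixes k :: nat and \<alpha> :: real
  assumes "k \<ge> 1" and "\<alpha> > 0"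
  shows "\<not> k_furcus k (N0_adjoin \<alpha>)"
proof
  assume furcus: "k_furcus k (N0_adjoin \<alpha>)"
  have sums: "\<exists>es. length es \<le> k \<and> (\<Sum>i\<leftarrow>es. \<alpha> ^ i) = real n" if "n > 0" for n
    using k_furcus_imp_sum_powers[OF assms(2) furcus that] by metis
  show False
  proof (cases "\<alpha> \<le> 1")
    case True
    obtain es where es: "length es \<le> k" "(\<Sum>i\<leftarrow>es. \<alpha> ^ i) = real (k + 1)"
      using sums[of "k + 1"] by auto
    \<comment> \<open>The right-hand side is the length of \<open>es\<close>, hence at most
      \<open>k\<close>.\<close>
    have "(\<Sum>i\<leftarrow>es. \<alpha> ^ i) \<le> (\<Sum>i\<leftarrow>es. 1)"
      using True assms(2) by (intro sum_list_mono) (auto simp: power_le_one)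
    with es show False by (simp add: sum_list_triv)
  next
    case False
    then have "\<alpha> > 1" by simp
    \<comment> \<open>For fixed \<open>k\<close>, exponential growth in \<open>N\<close> beats the
      polynomial bound from counting.\<close>
    then have "\<forall>\<^sub>F N in sequentially. \<alpha> ^ N > (real k + 1) * real N ^ k + 1"
      by real_asymp
    then have "\<forall>\<^sub>F N in sequentially. N > 0 \<and> \<alpha> ^ N > (real k + 1) * real N ^ k + 1"
      by (intro eventually_conj eventually_gt_at_top)
    then obtain N where "N > 0" "\<alpha> ^ N > (real k + 1) * real N ^ k + 1"
      unfolding eventually_sequentially by blast
    with power_le_if_sums_of_powers[OF \<open>\<alpha> > 1\<close> \<open>N > 0\<close> sums] show False
      by simp
  qed
qed

end
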